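(* Let $\mathbf{Y}=(\mathbf{Y}^1,\dots,\mathbf{Y}^n)$ be a sample of i.i.d. Gaussian vectors in $\mathbb{R}^K$ with mean $\mu$, and let $W$ be a resampling weight vector. Then, for any measurable positive homogeneous function $\phi:\mathbb{R}^K\to\mathbb{R}$ such that the expectations $\mathbb{E}[\phi(\overline{\mathbf{Y}}-\mu)]$ and $\mathbb{E}[\phi(\overline{\mathbf{Y}}^{\langle W-\overline{W}\rangle})]$ exist, $$B_W\,\mathbb{E}[\phi(\overline{\mathbf{Y}}-\mu)]=\mathbb{E}[\phi(\overline{\mathbf{Y}}^{\langle W-\overline{W}\rangle})].$$ If the weights are such that $\sum_{i=1}^n(W_i-\overline{W})^2=n$ (almost surely), then the equality $B_W\,\mathbb{E}[\phi(\overline{\mathbf{Y}}-\mu)]=\mathbb{E}[\phi(\overline{\mathbf{Y}}^{\langle W-\overline{W}\rangle})]$ holds for any measurable function $\phi:\mathbb{R}^K\to\mathbb{R}$ for which these expectations exist (and $B_W=1$).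
   Context: $K\ge1$ and $n\ge2$ are integers; the covariance matrix of the $\mathbf{Y}^i$ is arbitrary. $\overline{\mathbf{Y}}=\frac1n\sum_{i=1}^n\mathbf{Y}^i$, and for $w\in\mathbb{R}^n$, $\overline{\mathbf{Y}}^{\langle w\rangle}=\frac1n\sum_{i=1}^nw_i\mathbf{Y}^i$. Positive homogeneous means $\phi(\lambda x)=\lambda\phi(x)$ for all $x\in\mathbb{R}^K$ and $\lambda\in\mathbb{R}^+$. A resampling weight vector is an $\mathbb{R}^n$-valued random vector $W=(W_i)_{1\le i\le n}$, independent of $\mathbf{Y}$, with $\mathbb{E}[W_i^2]<\infty$ for all $i$ and $n^{-1}\sum_{i=1}^n\mathbb{E}|W_i-\overline{W}|>0$, where $\overline{W}=\frac1n\sum_{i=1}^nW_i$ (not necessarily exchangeable or independent coordinates). $W-\overline{W}$ denotes $(W_i-\overline{W})_{1\le i\le n}$, and $$B_W=\mathbb{E}\Big[\Big(\tfrac1n\sum_{i=1}^n(W_i-\overline{W})^2\Big)^{1/2}\Big].$$ *)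

theory Defs
  imports "HOL-Probability.Probability"
begin

text \<open>A sample \<open>(y\<^sub>1, \<dots>, y\<^sub>n)\<close> of vectors is an element of \<open>'v ^ 'n\<close> with \<open>n = CARD('n)\<close>.\<close>

definition emp_mean :: "'v::real_vector ^ 'n \<Rightarrow> 'v" where
  "emp_mean y = (1 / real CARD('n)) *\<^sub>R (\<Sum>i\<in>UNIV. y $ i)"

definition weighted_mean :: "real ^ 'n \<Rightarrow> 'v::real_vector ^ 'n \<Rightarrow> 'v" where
  "weighted_mean w y = (1 / real CARD('n)) *\<^sub>R (\<Sum>i\<in>UNIV. w $ i *\<^sub>R y $ i)"

definition centered :: "real ^ 'n \<Rightarrow> real ^ 'n" where
  "centered w = (\<chi> i. w $ i - emp_mean w)"

text \<open>Gaussian laws may be degenerate: point masses are included as the case of zero variance,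
  so that no condition is imposed on the covariance matrix of a Gaussian vector.\<close>

definition gaussian_variable :: "'a measure \<Rightarrow> ('a \<Rightarrow> real) \<Rightarrow> bool" where
  "gaussian_variable M X \<longleftrightarrow> X \<in> borel_measurable M \<and>
     (\<exists>m. (AE \<omega> in M. X \<omega> = m) \<or>
          (\<exists>\<sigma>>0. distributed M lborel X (\<lambda>x. ennreal (normal_density m \<sigma> x))))"

definition gaussian_vector :: "'a measure \<Rightarrow> ('a \<Rightarrow> real ^ 'k) \<Rightarrow> bool" where
  "gaussian_vector M X \<longleftrightarrow> X \<in> borel_measurable M \<and> (\<forall>u. gaussian_variable M (\<lambda>\<omega>. u \<bullet> X \<omega>))"

definition iid_gaussian_sample ::
  "'a measure \<Rightarrow> ('a \<Rightarrow> real ^ 'k ^ 'n) \<Rightarrow> real ^ 'k \<Rightarrow> bool" where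
  "iid_gaussian_sample M Y \<mu> \<longleftrightarrow>
     prob_space.indep_vars M (\<lambda>_. borel) (\<lambda>i \<omega>. Y \<omega> $ i) UNIV \<and>
     (\<forall>i j. distr M borel (\<lambda>\<omega>. Y \<omega> $ i) = distr M borel (\<lambda>\<omega>. Y \<omega> $ j)) \<and>
     (\<forall>i. gaussian_vector M (\<lambda>\<omega>. Y \<omega> $ i) \<and> (LINT \<omega>|M. Y \<omega> $ i) = \<mu>)"

text \<open>Independence of random vectors with values in different spaces (the library's \<open>indep_var\<close>
  requires a common value type): independence of the families of events they generate.\<close>

definition indep_vectors ::
  "'a measure \<Rightarrow> ('a \<Rightarrow> 'b::topological_space) \<Rightarrow> ('a \<Rightarrow> 'c::topological_space) \<Rightarrow> bool" where
  "indep_vectors M X Z \<longleftrightarrow> X \<in> borel_measurable M \<and> Z \<in> borel_measurable M \<and>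
     prob_space.indep_set M {X -` A \<inter> space M |A. A \<in> sets borel}
                            {Z -` B \<inter> space M |B. B \<in> sets borel}"

definition resampling_weight ::
  "'a measure \<Rightarrow> ('a \<Rightarrow> real ^ 'k ^ 'n) \<Rightarrow> ('a \<Rightarrow> real ^ 'n) \<Rightarrow> bool" where
  "resampling_weight M Y W \<longleftrightarrow>
     W \<in> borel_measurable M \<and> indep_vectors M W Y \<and>
     (\<forall>i. integrable M (\<lambda>\<omega>. (W \<omega> $ i)\<^sup>2)) \<and>
     (1 / real CARD('n)) * (\<Sum>i\<in>UNIV. LINT \<omega>|M. \<bar>W \<omega> $ i - emp_mean (W \<omega>)\<bar>) > 0"

definition resampling_B :: "'a measure \<Rightarrow> ('a \<Rightarrow> real ^ 'n) \<Rightarrow> real" where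
  "resampling_B M W =
     (LINT \<omega>|M. sqrt ((1 / real CARD('n)) * (\<Sum>i\<in>UNIV. (W \<omega> $ i - emp_mean (W \<omega>))\<^sup>2)))"

definition positive_homogeneous :: "(real ^ 'k \<Rightarrow> real) \<Rightarrow> bool" where
  "positive_homogeneous \<phi> \<longleftrightarrow> (\<forall>x. \<forall>c\<ge>0. \<phi> (c *\<^sub>R x) = c * \<phi> x)"

text \<open>The expectation of a real random variable \<open>X\<close> exists if the expectation of its positive part
  or that of its negative part is finite; it may then be infinite. Since \<open>ennreal\<close> sends negative
  numbers to \<open>0\<close>, the two integrals below are those of the positive and of the negative part.
  For integrable \<open>X\<close> the notion agrees with the Bochner integral (lemmas below).\<close>

definition expectation_exists :: "'a measure \<Rightarrow> ('a \<Rightarrow> real) \<Rightarrow> bool" where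
  "expectation_exists M X \<longleftrightarrow> X \<in> borel_measurable M \<and>
     ((\<integral>\<^sup>+\<omega>. ennreal (X \<omega>) \<partial>M) < \<infinity> \<or> (\<integral>\<^sup>+\<omega>. ennreal (- X \<omega>) \<partial>M) < \<infinity>)"

definition ext_expectation :: "'a measure \<Rightarrow> ('a \<Rightarrow> real) \<Rightarrow> ereal" where
  "ext_expectation M X =
     enn2ereal (\<integral>\<^sup>+\<omega>. ennreal (X \<omega>) \<partial>M) - enn2ereal (\<integral>\<^sup>+\<omega>. ennreal (- X \<omega>) \<partial>M)"

lemma expectation_exists_integrable:
  assumes "integrable M X"
  shows "expectation_exists M X"
  using assms by (auto simp: expectation_exists_def real_integrable_def less_top)

lemma ext_expectation_integrable:
  assumes "integrable M X"
  shows "ext_expectation M X = ereal (LINT \<omega>|M. X \<omega>)"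
proof -
  let ?p = "\<integral>\<^sup>+\<omega>. ennreal (X \<omega>) \<partial>M" and ?q = "\<integral>\<^sup>+\<omega>. ennreal (- X \<omega>) \<partial>M"
  have "?p \<noteq> \<infinity>" "?q \<noteq> \<infinity>"
    using assms by (auto simp: real_integrable_def)
  then obtain a b where "?p = ennreal a" "a \<ge> 0" "?q = ennreal b" "b \<ge> 0"
    by (cases ?p; cases ?q) auto
  then show ?thesis
    using real_lebesgue_integral_def[OF assms] by (simp add: ext_expectation_def enn2ereal_ennreal)
qed

end

theory Submission
  imports Defs "HOL-Real_Asymp.Real_Asymp"
begin

text \<open>Condition on \<open>W = w\<close>, and let \<open>n\<close> be the sample size. The coefficients \<open>(w\<^sub>i - emp_mean w) / n\<close> of the
  resampled mean sum to zero, so \<open>\<mu>\<close> may be subtracted from every \<open>Y\<^sup>i\<close>, and the resampled mean is a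
  linear combination of the centred i.i.d. Gaussian vectors \<open>Y\<^sup>i - \<mu>\<close>. The law of such a combination
  depends on its coefficients only through the sum of their squares
  (\<open>distr_linear_combination_iid_gaussian\<close>). That sum is \<open>s\<^sup>2 / n\<close> here, where
  \<open>s = empirical_sd w\<close>; it is the same for the equal coefficients \<open>s / n\<close>, which give \<open>s\<close> times the centred empirical mean. So, given \<open>W = w\<close>, the resampled mean has the law of
  \<open>s\<close> times the centred empirical mean. For a positive homogeneous \<open>\<phi>\<close> the factor \<open>s\<close> leaves \<open>\<phi>\<close>, and
  averaging over the independent weights turns it into its expectation \<open>resampling_B\<close>. If \<open>s = 1\<close>
  almost surely there is no factor to move, and \<open>\<phi>\<close> can be arbitrary. The positive and the negative
  part of \<open>\<phi>\<close> are treated separately by Tonelli's theorem, so infinite expectations are covered.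

  Gaussian vectors are given through their one-dimensional projections, so the equality of laws
  needs the uniqueness of characteristic functions on a Euclidean space (\<open>charfun_uniqueness\<close>).
  The map \<open>sin_box N\<close>, which replaces each coordinate \<open>y\<close> by \<open>N sin (y / N)\<close>, reduces this to
  the Weierstrass theorem: it turns polynomials into trigonometric polynomials, whose integrals
  the characteristic function determines, its range is bounded, and it tends pointwise to the
  identity as \<open>N\<close> grows.\<close>

section \<open>Characteristic functions determine laws on Euclidean spaces\<close>

text \<open>The indicator of a proper open subset \<open>U\<close> is the increasing limit of the continuous functions
  \<open>min 1 (m * infdist x (- U))\<close>, and the open sets generate the Borel sets.\<close>

lemma measure_eqI_bounded_continuous:
  fixes P Q :: "'v::metric_space measure"
  assumes "prob_space P" "prob_space Q" and sets: "sets P = sets borel" "sets Q = sets borel"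
    and eq: "\<And>f :: 'v \<Rightarrow> real. continuous_on UNIV f \<Longrightarrow> (\<And>x. \<bar>f x\<bar> \<le> 1) \<Longrightarrow>
      (LINT x|P. f x) = (LINT x|Q. f x)"
  shows "P = Q"
proof -
  interpret P: prob_space P by fact
  interpret Q: prob_space Q by fact
  have sp: "space P = UNIV" "space Q = UNIV"
    using sets[THEN sets_eq_imp_space_eq] by auto
  have meas: "g \<in> borel_measurable P" "g \<in> borel_measurable Q"
    if "g \<in> borel_measurable borel" for g :: "'v \<Rightarrow> real"
    using that measurable_cong_sets[OF sets(1) refl] measurable_cong_sets[OF sets(2) refl] by auto
  have *: "measure P U = measure Q U" if U: "open U" for U
    \<comment> \<open>\<open>infdist\<close> to the empty set is \<open>0\<close>, so the approximation fails for the whole space.\<close>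
  proof (cases "U = UNIV")
    case True
    then show ?thesis using P.prob_space Q.prob_space sp by simp
  next
    case False
    define f where "f m x = min 1 (real m * infdist x (- U))" for m x
    have cont: "continuous_on UNIV (f m)" for m
      unfolding f_def by (intro continuous_intros)
    have bound: "\<bar>f m x\<bar> \<le> 1" for m x
      by (simp add: f_def infdist_nonneg)
    have lim: "(\<lambda>m. f m x) \<longlonglongrightarrow> indicator U x" for x
    proof (cases "x \<in> U")
      case True
      have "infdist x (- U) \<noteq> 0"
        using in_closed_iff_infdist_zero[of "- U" x] U False True by auto
      then have pos: "infdist x (- U) > 0"
        using infdist_nonneg[of x "- U"] by linarith
      obtain m0 where m0: "1 < real m0 * infdist x (- U)"
        using reals_Archimedean3[OF pos] by blast
      have "f m x = 1" if "m \<ge> m0" for m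
      proof -
        have "real m0 * infdist x (- U) \<le> real m * infdist x (- U)"
          using that pos by simp
        then show ?thesis using m0 by (simp add: f_def)
      qed
      then have "\<forall>\<^sub>F m in sequentially. f m x = indicator U x"
        using True by (auto simp: eventually_sequentially)
      then show ?thesis by (rule tendsto_eventually)
    next
      case False
      then show ?thesis by (simp add: f_def)
    qed
    have fm: "f m \<in> borel_measurable borel" for m
      by (rule borel_measurable_continuous_onI) (rule cont)
    have iU: "indicat_real U \<in> borel_measurable borel"
      using U by simp
    have "(\<lambda>m. LINT x|P. f m x) \<longlonglongrightarrow> (LINT x|P. indicator U x)"
      by (rule integral_dominated_convergence[where w="\<lambda>_. 1",
            OF meas(1)[OF iU] meas(1)[OF fm] _ AE_I2[OF lim]])
        (simp_all add: bound)
    moreover have "(\<lambda>m. LINT x|Q. f m x) \<longlonglongrightarrow> (LINT x|Q. indicator U x)"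
      by (rule integral_dominated_convergence[where w="\<lambda>_. 1",
            OF meas(2)[OF iU] meas(2)[OF fm] _ AE_I2[OF lim]])
        (simp_all add: bound)
    ultimately have "(LINT x|P. indicat_real U x) = (LINT x|Q. indicator U x)"
      using eq[OF cont bound] LIMSEQ_unique by auto
    then show ?thesis using sp by simp
  qed
  show ?thesis
  proof (rule measure_eqI_generator_eq[where E="Collect open" and \<Omega>=UNIV and A="\<lambda>_. UNIV"])
    show "Int_stable (Collect open :: 'v set set)"
      by (auto simp: Int_stable_def)
    show "sets P = sigma_sets UNIV (Collect open)" "sets Q = sigma_sets UNIV (Collect open)"
      using sets by (auto simp: borel_def)
    show "emeasure P X = emeasure Q X" if "X \<in> Collect open" for X
      using * that by (simp add: P.emeasure_eq_measure Q.emeasure_eq_measure)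
  qed auto
qed

inductive trig_polynomial :: "('v::real_inner \<Rightarrow> complex) \<Rightarrow> bool" where
  wave: "trig_polynomial (\<lambda>x. c * iexp (u \<bullet> x))"
| add: "trig_polynomial f \<Longrightarrow> trig_polynomial g \<Longrightarrow> trig_polynomial (\<lambda>x. f x + g x)"

lemma trig_polynomial_const: "trig_polynomial (\<lambda>_. c)"
  using trig_polynomial.wave[of c 0] by simp

lemma trig_polynomial_sum:
  "(\<And>i. i \<in> A \<Longrightarrow> trig_polynomial (f i)) \<Longrightarrow> trig_polynomial (\<lambda>x. \<Sum>i\<in>A. f i x)"
  by (induction A rule: infinite_finite_induct)
    (auto intro: trig_polynomial_const trig_polynomial.add)

text \<open>The frequencies of a product of two waves add up; hence trigonometric polynomials form an
  algebra.\<close>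

lemma trig_polynomial_wave_mult:
  assumes "trig_polynomial g"
  shows "trig_polynomial (\<lambda>x. c * iexp (u \<bullet> x) * g x)"
  using assms
proof induction
  case (wave d v)
  have "(\<lambda>x. c * iexp (u \<bullet> x) * (d * iexp (v \<bullet> x))) = (\<lambda>x. (c * d) * iexp ((u + v) \<bullet> x))"
    by (auto simp: inner_add_left exp_add algebra_simps)
  then show ?case by (simp only: trig_polynomial.wave)
next
  case (add f g)
  then show ?case by (simp add: distrib_left trig_polynomial.add)
qed

lemma trig_polynomial_mult:
  assumes "trig_polynomial f" "trig_polynomial g"
  shows "trig_polynomial (\<lambda>x. f x * g x)"
  using assms(1)
  by induction (use trig_polynomial_wave_mult[OF assms(2)] in
    \<open>auto simp: distrib_right intro: trig_polynomial.add\<close>)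

lemma trig_polynomial_sin: "trig_polynomial (\<lambda>x. c * complex_of_real (sin (u \<bullet> x)))"
proof -
  have "c * complex_of_real (sin (u \<bullet> x)) =
      (c / (2 * \<i>)) * iexp (u \<bullet> x) + (- c / (2 * \<i>)) * iexp ((- u) \<bullet> x)" for x
  proof -
    have "complex_of_real (sin (u \<bullet> x)) = (iexp (u \<bullet> x) - iexp ((- u) \<bullet> x)) / (2 * \<i>)"
      using sin_exp_eq[of "complex_of_real (u \<bullet> x)"] by (simp add: sin_of_real)
    then show ?thesis
      by (simp only:) (simp add: algebra_simps diff_divide_distrib)
  qed
  then show ?thesis
    by (simp only: trig_polynomial.intros)
qed

lemma continuous_on_trig_polynomial: "trig_polynomial f \<Longrightarrow> continuous_on UNIV f"
  by (induction rule: trig_polynomial.induct) (auto intro!: continuous_intros)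

lemma integrable_trig_polynomial:
  assumes "prob_space P" "sets P = sets borel" "trig_polynomial f"
  shows "integrable P f"
proof -
  interpret P: prob_space P by fact
  have "\<exists>B. \<forall>x. norm (f x) \<le> B"
    using assms(3)
  proof induction
    case (wave c u)
    show ?case by (rule exI[of _ "norm c"]) (simp add: norm_mult)
  next
    case (add f g)
    then obtain B C where "\<forall>x. norm (f x) \<le> B" "\<forall>x. norm (g x) \<le> C" by blast
    then have "\<forall>x. norm (f x + g x) \<le> B + C" by (meson add_mono norm_triangle_le)
    then show ?case by blast
  qed
  then obtain B where B: "\<And>x. norm (f x) \<le> B" by blast
  have "f \<in> borel_measurable P"
    using borel_measurable_continuous_onI[OF continuous_on_trig_polynomial[OF assms(3)]]
      measurable_cong_sets[OF assms(2) refl] by auto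
  then show ?thesis
    using B by (intro P.integrable_const_bound[where B=B]) auto
qed

text \<open>A bounded substitute for the identity, built from sines so that polynomials in it stay
  trigonometric; it is close to the identity at points that are small compared to \<open>N\<close>.\<close>

definition sin_box :: "real \<Rightarrow> 'v::euclidean_space \<Rightarrow> 'v" where
  "sin_box N x = (\<Sum>b\<in>Basis. (N * sin (b \<bullet> x / N)) *\<^sub>R b)"

lemma trig_polynomial_sin_box:
  fixes p :: "'v::euclidean_space \<Rightarrow> real"
  assumes "real_polynomial_function p"
  shows "trig_polynomial (\<lambda>x. complex_of_real (p (sin_box N x)))"
  using assms
proof induction
  case (linear f)
  have "complex_of_real (f (sin_box N x)) =
      (\<Sum>b\<in>Basis. complex_of_real (N * f b) * complex_of_real (sin ((b /\<^sub>R N) \<bullet> x)))" for x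
    using linear
    by (simp add: sin_box_def linear_sum[OF bounded_linear.linear] linear_scale[OF bounded_linear.linear]
        field_simps)
  then show ?case
    by (simp only:) (intro trig_polynomial_sum trig_polynomial_sin)
next
  case (const c)
  then show ?case by (rule trig_polynomial_const)
next
  case (add f g)
  then show ?case using trig_polynomial.add[OF add.IH] by simp
next
  case (mult f g)
  then show ?case using trig_polynomial_mult[OF mult.IH] by simp
qed

lemma sin_box_tendsto: "(\<lambda>n. sin_box (real (Suc n)) x) \<longlonglongrightarrow> x"
proof -
  have "(\<lambda>n. real (Suc n) * sin (y / real (Suc n))) \<longlonglongrightarrow> y" for y
    by real_asymp
  then have "(\<lambda>n. \<Sum>b\<in>Basis. (real (Suc n) * sin (b \<bullet> x / real (Suc n))) *\<^sub>R b)
      \<longlonglongrightarrow> (\<Sum>b\<in>Basis. (b \<bullet> x) *\<^sub>R b)"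
    by (intro tendsto_intros)
  then show ?thesis
    by (simp add: sin_box_def inner_commute[of _ x] euclidean_representation)
qed

lemma continuous_on_sin_box: "continuous_on UNIV (sin_box N)"
  unfolding sin_box_def by (cases "N = 0") (auto intro!: continuous_intros)

lemma sin_box_in_cbox:
  assumes "N \<ge> 0"
  shows "sin_box N x \<in> cbox (- (\<Sum>b\<in>Basis. N *\<^sub>R b)) (\<Sum>b\<in>Basis. N *\<^sub>R b)"
proof -
  have "- N \<le> N * sin y \<and> N * sin y \<le> N" for y
    using assms mult_left_mono[OF sin_le_one[of y] assms] mult_left_mono[OF sin_ge_minus_one[of y] assms]
    by simp
  then show ?thesis
    by (simp add: mem_box sin_box_def del: scaleR_scaleR)
qed

text \<open>On the compact box that contains the range of \<open>sin_box N\<close>, a continuous \<open>f\<close> is a uniform limit of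
  polynomials \<open>p\<close>. The integrals of the trigonometric polynomials \<open>p (sin_box N x)\<close> agree, hence so
  do those of \<open>f (sin_box N x)\<close>, and letting \<open>N\<close> tend to infinity removes \<open>sin_box\<close>. The bound on
  \<open>f - p\<close> over the box holds for \<open>f (sin_box N x) - p (sin_box N x)\<close> at every \<open>x\<close>, so the mass that the
  measures have far away contributes no error.\<close>

theorem charfun_uniqueness:
  fixes P Q :: "'v::euclidean_space measure"
  assumes P: "prob_space P" "sets P = sets borel" and Q: "prob_space Q" "sets Q = sets borel"
    and char: "\<And>u. (CLINT x|P. iexp (u \<bullet> x)) = (CLINT x|Q. iexp (u \<bullet> x))"
  shows "P = Q"
proof (rule measure_eqI_bounded_continuous[OF P(1) Q(1) P(2) Q(2)])
  interpret P: prob_space P by fact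
  interpret Q: prob_space Q by fact
  fix f :: "'v \<Rightarrow> real"
  assume cont: "continuous_on UNIV f" and bound: "\<And>x. \<bar>f x\<bar> \<le> 1"
  have meas: "g \<in> borel_measurable P" "g \<in> borel_measurable Q"
    if "continuous_on UNIV g" for g :: "'v \<Rightarrow> real"
    using borel_measurable_continuous_onI[OF that]
      measurable_cong_sets[OF P(2) refl] measurable_cong_sets[OF Q(2) refl] by auto
  have trig: "(CLINT x|P. g x) = (CLINT x|Q. g x)" if "trig_polynomial g" for g
    using that
  proof induction
    case (wave c u)
    then show ?case by (simp add: char)
  next
    case (add f g)
    then show ?case
      using integrable_trig_polynomial[OF P] integrable_trig_polynomial[OF Q] by simp
  qed
  have compf: "continuous_on UNIV (\<lambda>x. f (sin_box N x))" for N
    by (rule continuous_on_compose2[OF cont continuous_on_sin_box]) simp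
  have box: "(LINT x|P. f (sin_box N x)) = (LINT x|Q. f (sin_box N x))" if N: "N \<ge> 0" for N
  proof (rule ccontr)
    assume ne: "\<not> ?thesis"
    define e where "e = \<bar>(LINT x|P. f (sin_box N x)) - (LINT x|Q. f (sin_box N x))\<bar> / 2"
    have "e > 0" using ne by (simp add: e_def)
    obtain p where p: "real_polynomial_function p" and
      close: "\<And>x. x \<in> cbox (- (\<Sum>b\<in>Basis. N *\<^sub>R b)) (\<Sum>b\<in>Basis. N *\<^sub>R b :: 'v) \<Longrightarrow> \<bar>f x - p x\<bar> < e"
      using Stone_Weierstrass_real_polynomial_function[OF compact_cbox
          continuous_on_subset[OF cont subset_UNIV] \<open>e > 0\<close>] by blast
    have tp: "trig_polynomial (\<lambda>x. complex_of_real (p (sin_box N x)))"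
      by (rule trig_polynomial_sin_box[OF p])
    have int: "integrable P (\<lambda>x. p (sin_box N x))" "integrable Q (\<lambda>x. p (sin_box N x))"
      using integrable_trig_polynomial[OF P tp] integrable_trig_polynomial[OF Q tp]
      by (auto dest: integrable_Re)
    have intf: "integrable P (\<lambda>x. f (sin_box N x))" "integrable Q (\<lambda>x. f (sin_box N x))"
      using bound meas[OF compf]
      by (auto intro!: P.integrable_const_bound[where B=1] Q.integrable_const_bound[where B=1])
    have le: "\<bar>f (sin_box N x) - p (sin_box N x)\<bar> < e" for x
      by (rule close[OF sin_box_in_cbox[OF N]])
    have "complex_of_real (LINT x|P. p (sin_box N x)) = complex_of_real (LINT x|Q. p (sin_box N x))"
      using trig[OF tp] by simp
    then have eqp: "(LINT x|P. p (sin_box N x)) = (LINT x|Q. p (sin_box N x))"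
      by simp
    have "\<bar>(LINT x|P. f (sin_box N x)) - (LINT x|P. p (sin_box N x))\<bar> < e"
    proof -
      have "\<bar>LINT x|P. f (sin_box N x) - p (sin_box N x)\<bar> \<le> (LINT x|P. \<bar>f (sin_box N x) - p (sin_box N x)\<bar>)"
        by simp
      also have "\<dots> < e"
        using le int intf by (intro P.expectation_less) auto
      finally show ?thesis using int intf by simp
    qed
    moreover have "\<bar>(LINT x|Q. f (sin_box N x)) - (LINT x|Q. p (sin_box N x))\<bar> < e"
    proof -
      have "\<bar>LINT x|Q. f (sin_box N x) - p (sin_box N x)\<bar> \<le> (LINT x|Q. \<bar>f (sin_box N x) - p (sin_box N x)\<bar>)"
        by simp
      also have "\<dots> < e"
        using le int intf by (intro Q.expectation_less) auto
      finally show ?thesis using int intf by simp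
    qed
    ultimately show False using eqp unfolding e_def by argo
  qed
  have lim: "(\<lambda>n. f (sin_box (real (Suc n)) x)) \<longlonglongrightarrow> f x" for x
    using cont by (intro isCont_tendsto_compose[OF _ sin_box_tendsto]) (simp add: continuous_on_eq_continuous_at)
  have "(\<lambda>n. LINT x|P. f (sin_box (real (Suc n)) x)) \<longlonglongrightarrow> (LINT x|P. f x)"
    by (rule integral_dominated_convergence[where w="\<lambda>_. 1",
          OF meas(1)[OF cont] meas(1)[OF compf] _ AE_I2[OF lim]])
      (simp_all add: bound)
  moreover have "(\<lambda>n. LINT x|Q. f (sin_box (real (Suc n)) x)) \<longlonglongrightarrow> (LINT x|Q. f x)"
    by (rule integral_dominated_convergence[where w="\<lambda>_. 1",
          OF meas(2)[OF cont] meas(2)[OF compf] _ AE_I2[OF lim]])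
      (simp_all add: bound)
  ultimately show "(LINT x|P. f x) = (LINT x|Q. f x)"
    using box LIMSEQ_unique by auto
qed

section \<open>Linear combinations of i.i.d. Gaussian vectors\<close>

text \<open>The witness \<open>v\<close> is the variance; \<open>v = 0\<close> is the case of a point mass.\<close>
lemma (in prob_space) char_centered_gaussian:
  assumes "gaussian_variable M X"
  shows "\<exists>v. \<forall>t. char (distr M borel (\<lambda>\<omega>. X \<omega> - expectation X)) t
    = complex_of_real (exp (- (v * t\<^sup>2 / 2)))"
proof -
  have X [measurable]: "X \<in> borel_measurable M"
    using assms by (simp add: gaussian_variable_def)
  obtain m where m: "(AE \<omega> in M. X \<omega> = m) \<or>
      (\<exists>\<sigma>>0. distributed M lborel X (\<lambda>x. ennreal (normal_density m \<sigma> x)))"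
    using assms by (auto simp: gaussian_variable_def)
  have char_eq: "char (distr M borel Z) t = (CLINT \<omega>|M. iexp (t * Z \<omega>))"
    if "Z \<in> borel_measurable M" for Z :: "'a \<Rightarrow> real" and t
    using that by (simp add: char_def integral_distr)
  show ?thesis
    using m
  proof (elim disjE exE conjE)
    assume ae: "AE \<omega> in M. X \<omega> = m"
    have "expectation X = expectation (\<lambda>_. m)"
      by (rule integral_cong_AE) (use ae in auto)
    then have E: "expectation X = m"
      by (simp add: prob_space)
    have "(CLINT \<omega>|M. iexp (t * (X \<omega> - expectation X))) = (CLINT \<omega>|M. 1)" for t
      unfolding E by (rule integral_cong_AE) (use ae in auto)
    then show ?thesis
      by (intro exI[of _ 0]) (simp add: char_eq prob_space)
  next
    fix \<sigma> :: real
    assume \<sigma>: "\<sigma> > 0" and D: "distributed M lborel X (\<lambda>x. ennreal (normal_density m \<sigma> x))"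
    have E: "expectation X = m"
      by (rule normal_distributed_expectation[OF \<sigma> D])
    have "distributed M lborel (\<lambda>x. (X x - m) / \<sigma>) std_normal_density"
      using D normal_standard_normal_convert[OF \<sigma>, of X m] by simp
    then have std: "distr M borel (\<lambda>x. (X x - m) / \<sigma>) = std_normal_distribution"
      using distributed_distr_eq_density[of M lborel "\<lambda>x. (X x - m) / \<sigma>"]
      by (simp cong: distr_cong)
    have "char (distr M borel (\<lambda>\<omega>. X \<omega> - expectation X)) t
        = char (distr M borel (\<lambda>x. (X x - m) / \<sigma>)) (t * \<sigma>)" for t
      using \<sigma> by (simp add: char_eq E)
    then show ?thesis
      by (intro exI[of _ "\<sigma>\<^sup>2"])
        (simp add: std char_std_normal_distribution power_mult_distrib mult.commute)
  qed
qed

lemma (in prob_space) integrable_gaussian_variable: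
  assumes "gaussian_variable M X"
  shows "integrable M X"
proof -
  have X [measurable]: "X \<in> borel_measurable M"
    using assms by (simp add: gaussian_variable_def)
  obtain m where m: "(AE \<omega> in M. X \<omega> = m) \<or>
      (\<exists>\<sigma>>0. distributed M lborel X (\<lambda>x. ennreal (normal_density m \<sigma> x)))"
    using assms by (auto simp: gaussian_variable_def)
  then show ?thesis
  proof (elim disjE exE conjE)
    assume ae: "AE \<omega> in M. X \<omega> = m"
    show ?thesis
      by (rule integrable_cong_AE_imp[where g="\<lambda>_. m"]) (use ae in auto)
  next
    fix \<sigma> :: real
    assume \<sigma>: "\<sigma> > 0" and D: "distributed M lborel X (\<lambda>x. ennreal (normal_density m \<sigma> x))"
    show ?thesis
      using integrable_normal_moment_nz_1[OF \<sigma>, of m] distributed_integrable[OF D, of "\<lambda>x. x"] by simp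
  qed
qed

lemma (in prob_space) integrable_gaussian_vector:
  assumes "gaussian_vector M (X :: 'a \<Rightarrow> real ^ 'k)"
  shows "integrable M X"
proof -
  have "integrable M (\<lambda>\<omega>. b \<bullet> X \<omega>)" for b
    using integrable_gaussian_variable assms by (auto simp: gaussian_vector_def)
  then have "integrable M (\<lambda>\<omega>. X \<omega> \<bullet> b)" for b
    by (simp only: inner_commute[of "X _" b])
  then have "integrable M (\<lambda>\<omega>. \<Sum>b\<in>Basis. (X \<omega> \<bullet> b) *\<^sub>R b)"
    by auto
  then show ?thesis
    by (simp add: euclidean_representation)
qed

text \<open>By independence the characteristic function factorizes, and as the \<open>Y\<^sup>i\<close> share one law, the factor
  of index \<open>i\<close> is \<open>exp (- v (a i)\<^sup>2 / 2)\<close> with the same \<open>v\<close>, the variance of \<open>u \<bullet> Y\<^sup>i\<close>. What matters below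
  is the order of the quantifiers: \<open>v\<close> depends on \<open>u\<close> but not on \<open>a\<close>.\<close>

lemma (in prob_space) iexp_linear_combination_iid_gaussian:
  fixes Y :: "'a \<Rightarrow> real ^ 'k ^ 'n"
  assumes iid: "iid_gaussian_sample M Y \<mu>"
  shows "\<exists>v. \<forall>a. (CLINT \<omega>|M. iexp (u \<bullet> (\<Sum>i\<in>UNIV. a i *\<^sub>R (Y \<omega> $ i - \<mu>))))
    = complex_of_real (exp (- (v * (\<Sum>i\<in>UNIV. (a i)\<^sup>2) / 2)))"
proof -
  have ind: "indep_vars (\<lambda>_. borel) (\<lambda>i \<omega>. Y \<omega> $ i) UNIV"
    and same: "distr M borel (\<lambda>\<omega>. Y \<omega> $ i) = distr M borel (\<lambda>\<omega>. Y \<omega> $ j)"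
    and gauss: "gaussian_vector M (\<lambda>\<omega>. Y \<omega> $ i)" and mean: "(LINT \<omega>|M. Y \<omega> $ i) = \<mu>" for i j
    using iid unfolding iid_gaussian_sample_def by blast+
  have meas [measurable]: "(\<lambda>\<omega>. Y \<omega> $ i) \<in> borel_measurable M" for i
    using gauss by (simp add: gaussian_vector_def)
  \<comment> \<open>The projection as a function of one observation, so that independence and equality of laws
    carry over from the observations.\<close>
  define g where "g t y = t * (u \<bullet> (y - \<mu>))" for t :: real and y
  have g [measurable]: "g t \<in> borel_measurable borel" for t
    unfolding g_def by measurable
  obtain i0 :: 'n where True by simp
  have "gaussian_variable M (\<lambda>\<omega>. u \<bullet> Y \<omega> $ i0)"
    using gauss by (simp add: gaussian_vector_def)
  from char_centered_gaussian[OF this] obtain v where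
    v: "\<And>t. char (distr M borel (\<lambda>\<omega>. u \<bullet> Y \<omega> $ i0 - expectation (\<lambda>\<omega>. u \<bullet> Y \<omega> $ i0))) t
      = complex_of_real (exp (- (v * t\<^sup>2 / 2)))" by blast
  have E: "expectation (\<lambda>\<omega>. u \<bullet> Y \<omega> $ i0) = u \<bullet> \<mu>"
    using integrable_gaussian_vector[OF gauss] mean by simp
  have single: "char (distr M borel (\<lambda>\<omega>. g t (Y \<omega> $ i))) 1 = complex_of_real (exp (- (v * t\<^sup>2 / 2)))" for t i
  proof -
    have "distr M borel (\<lambda>\<omega>. g t (Y \<omega> $ i)) = distr (distr M borel (\<lambda>\<omega>. Y \<omega> $ i)) borel (g t)"
      by (simp add: distr_distr comp_def)
    also have "\<dots> = distr M borel (\<lambda>\<omega>. g t (Y \<omega> $ i0))"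
      by (subst same[of i i0]) (simp add: distr_distr comp_def)
    finally show ?thesis
      using v[of t] by (simp add: char_def integral_distr g_def inner_diff_right E)
  qed
  show ?thesis
  proof (intro exI allI)
    fix a :: "'n \<Rightarrow> real"
    have "(CLINT \<omega>|M. iexp (u \<bullet> (\<Sum>i\<in>UNIV. a i *\<^sub>R (Y \<omega> $ i - \<mu>))))
        = char (distr M borel (\<lambda>\<omega>. \<Sum>i\<in>UNIV. g (a i) (Y \<omega> $ i))) 1"
      by (simp add: char_def integral_distr g_def inner_sum_right)
    also have "\<dots> = (\<Prod>i\<in>UNIV. char (distr M borel (\<lambda>\<omega>. g (a i) (Y \<omega> $ i))) 1)"
      by (rule char_distr_sum, rule indep_vars_compose2[OF ind]) simp
    also have "\<dots> = complex_of_real (exp (- (v * (\<Sum>i\<in>UNIV. (a i)\<^sup>2) / 2)))"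
      by (simp add: single of_real_prod[symmetric] exp_sum[symmetric] sum_negf
          sum_distrib_left sum_divide_distrib del: of_real_prod)
    finally show "(CLINT \<omega>|M. iexp (u \<bullet> (\<Sum>i\<in>UNIV. a i *\<^sub>R (Y \<omega> $ i - \<mu>))))
      = complex_of_real (exp (- (v * (\<Sum>i\<in>UNIV. (a i)\<^sup>2) / 2)))" .
  qed
qed

lemma (in prob_space) distr_linear_combination_iid_gaussian:
  fixes Y :: "'a \<Rightarrow> real ^ 'k ^ 'n"
  assumes iid: "iid_gaussian_sample M Y \<mu>"
    and ab: "(\<Sum>i\<in>UNIV. (a i)\<^sup>2) = (\<Sum>i\<in>UNIV. (b i)\<^sup>2)"
  shows "distr M borel (\<lambda>\<omega>. \<Sum>i\<in>UNIV. a i *\<^sub>R (Y \<omega> $ i - \<mu>))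
    = distr M borel (\<lambda>\<omega>. \<Sum>i\<in>UNIV. b i *\<^sub>R (Y \<omega> $ i - \<mu>))"
proof (rule charfun_uniqueness)
  have [measurable]: "(\<lambda>\<omega>. Y \<omega> $ i) \<in> borel_measurable M" for i
    using iid by (auto simp: iid_gaussian_sample_def gaussian_vector_def)
  show "prob_space (distr M borel (\<lambda>\<omega>. \<Sum>i\<in>UNIV. a i *\<^sub>R (Y \<omega> $ i - \<mu>)))"
    "prob_space (distr M borel (\<lambda>\<omega>. \<Sum>i\<in>UNIV. b i *\<^sub>R (Y \<omega> $ i - \<mu>)))"
    by (auto intro!: prob_space_distr)
  fix u :: "real ^ 'k"
  obtain v where "\<And>a. (CLINT \<omega>|M. iexp (u \<bullet> (\<Sum>i\<in>UNIV. a i *\<^sub>R (Y \<omega> $ i - \<mu>))))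
    = complex_of_real (exp (- (v * (\<Sum>i\<in>UNIV. (a i)\<^sup>2) / 2)))"
    using iexp_linear_combination_iid_gaussian[OF iid, of u] by blast
  note v = this[of a] this[of b]
  then show "(CLINT x|distr M borel (\<lambda>\<omega>. \<Sum>i\<in>UNIV. a i *\<^sub>R (Y \<omega> $ i - \<mu>)). iexp (u \<bullet> x))
    = (CLINT x|distr M borel (\<lambda>\<omega>. \<Sum>i\<in>UNIV. b i *\<^sub>R (Y \<omega> $ i - \<mu>)). iexp (u \<bullet> x))"
    by (simp add: integral_distr ab)
qed auto

section \<open>The resampled mean for fixed weights\<close>

definition empirical_sd :: "real ^ 'n \<Rightarrow> real" where
  "empirical_sd w = sqrt ((1 / real CARD('n)) * (\<Sum>i\<in>UNIV. (w $ i - emp_mean w)\<^sup>2))"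

lemma empirical_sd_nonneg: "empirical_sd w \<ge> 0"
  by (simp add: empirical_sd_def sum_nonneg)

lemma empirical_sd_power2:
  fixes w :: "real ^ 'n"
  shows "(empirical_sd w)\<^sup>2 = (\<Sum>i\<in>UNIV. (centered w $ i)\<^sup>2) / real CARD('n)"
  by (simp add: empirical_sd_def sum_nonneg centered_def)

lemma sum_centered: "(\<Sum>i\<in>UNIV. centered w $ i) = 0"
  by (simp add: centered_def emp_mean_def sum_subtractf)

lemma weighted_mean_centered:
  fixes y :: "real ^ 'k ^ 'n"
  shows "weighted_mean (centered w) y =
    (\<Sum>i\<in>UNIV. (centered w $ i / real CARD('n)) *\<^sub>R (y $ i - \<mu>))"
proof -
  have "(\<Sum>i\<in>UNIV. (centered w $ i / real CARD('n)) *\<^sub>R \<mu>) = 0"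
    by (simp flip: scaleR_left.sum sum_divide_distrib add: sum_centered)
  then show ?thesis
    by (simp add: weighted_mean_def scaleR_sum_right scaleR_diff_right sum_subtractf)
qed

lemma emp_mean_minus:
  fixes y :: "real ^ 'k ^ 'n"
  shows "s *\<^sub>R (emp_mean y - \<mu>) = (\<Sum>i\<in>UNIV. (s / real CARD('n)) *\<^sub>R (y $ i - \<mu>))"
proof -
  have "(\<Sum>i\<in>(UNIV::'n set). (s / real CARD('n)) *\<^sub>R \<mu>) = s *\<^sub>R \<mu>"
    by (simp add: sum_constant_scaleR del: sum_constant)
  then show ?thesis
    by (simp add: emp_mean_def scaleR_sum_right scaleR_diff_right sum_subtractf)
qed

text \<open>Both sides are linear combinations of the \<open>Y\<^sup>i - \<mu>\<close>, and \<open>empirical_sd w\<close> is the factor for which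
  their coefficients have the same sum of squares.\<close>

lemma (in prob_space) distr_weighted_mean_centered:
  fixes Y :: "'a \<Rightarrow> real ^ 'k ^ 'n" and w :: "real ^ 'n"
  assumes iid: "iid_gaussian_sample M Y \<mu>"
  shows "distr M borel (\<lambda>\<omega>. weighted_mean (centered w) (Y \<omega>))
    = distr M borel (\<lambda>\<omega>. empirical_sd w *\<^sub>R (emp_mean (Y \<omega>) - \<mu>))"
  unfolding weighted_mean_centered[of w _ \<mu>] emp_mean_minus
proof (rule distr_linear_combination_iid_gaussian[OF iid])
  show "(\<Sum>i\<in>UNIV. (centered w $ i / real CARD('n))\<^sup>2)
      = (\<Sum>i\<in>(UNIV::'n set). (empirical_sd w / real CARD('n))\<^sup>2)"
    by (simp add: power_divide empirical_sd_power2 flip: sum_divide_distrib)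
qed

section \<open>Averaging over the weights\<close>

lemma (in prob_space) distr_indep_vectors:
  fixes X :: "'a \<Rightarrow> 'b::second_countable_topology" and Z :: "'a \<Rightarrow> 'c::second_countable_topology"
  assumes "indep_vectors M X Z"
  shows "distr M borel (\<lambda>\<omega>. (X \<omega>, Z \<omega>)) = distr M borel X \<Otimes>\<^sub>M distr M borel Z"
proof (rule sym, rule pair_measure_eqI)
  have [measurable]: "X \<in> borel_measurable M" "Z \<in> borel_measurable M"
    and ind: "indep_set {X -` A \<inter> space M |A. A \<in> sets borel} {Z -` B \<inter> space M |B. B \<in> sets borel}"
    using assms by (auto simp: indep_vectors_def)
  interpret X: prob_space "distr M borel X" by (rule prob_space_distr) simp
  interpret Z: prob_space "distr M borel Z" by (rule prob_space_distr) simp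
  show "sigma_finite_measure (distr M borel X)" "sigma_finite_measure (distr M borel Z)"
    by unfold_locales
  show "sets (distr M borel X \<Otimes>\<^sub>M distr M borel Z) = sets (distr M borel (\<lambda>\<omega>. (X \<omega>, Z \<omega>)))"
    by (simp add: borel_prod[symmetric])
  fix A B assume "A \<in> sets (distr M borel X)" "B \<in> sets (distr M borel Z)"
  then have A [measurable]: "A \<in> sets borel" and B [measurable]: "B \<in> sets borel" by auto
  have "A \<times> B \<in> sets borel"
    unfolding borel_prod[symmetric] using A B by simp
  moreover have "(\<lambda>\<omega>. (X \<omega>, Z \<omega>)) -` (A \<times> B) \<inter> space M = (X -` A \<inter> space M) \<inter> (Z -` B \<inter> space M)"
    by auto
  moreover have "prob ((X -` A \<inter> space M) \<inter> (Z -` B \<inter> space M))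
      = prob (X -` A \<inter> space M) * prob (Z -` B \<inter> space M)"
    by (rule indep_setD[OF ind]) (use A B in auto)
  ultimately show "emeasure (distr M borel X) A * emeasure (distr M borel Z) B
      = emeasure (distr M borel (\<lambda>\<omega>. (X \<omega>, Z \<omega>))) (A \<times> B)"
    by (simp add: emeasure_distr emeasure_eq_measure ennreal_mult)
qed

text \<open>Tonelli's theorem on the product of the two laws, written on the original probability space: \<open>Z\<close> is
  evaluated at an independent copy \<open>\<omega>'\<close> of \<open>\<omega>\<close>.\<close>

lemma (in prob_space) nn_integral_indep_vectors:
  fixes X :: "'a \<Rightarrow> 'b::second_countable_topology" and Z :: "'a \<Rightarrow> 'c::second_countable_topology"
  assumes ind: "indep_vectors M X Z" and h [measurable]: "h \<in> borel_measurable borel"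
  shows "(\<integral>\<^sup>+\<omega>. h (X \<omega>, Z \<omega>) \<partial>M) = (\<integral>\<^sup>+\<omega>. \<integral>\<^sup>+\<omega>'. h (X \<omega>, Z \<omega>') \<partial>M \<partial>M)"
proof -
  have [measurable]: "X \<in> borel_measurable M" "Z \<in> borel_measurable M"
    using ind by (auto simp: indep_vectors_def)
  have h' [measurable]: "h \<in> borel_measurable (borel \<Otimes>\<^sub>M borel)"
    by (simp add: borel_prod)
  interpret Z: prob_space "distr M borel Z" by (rule prob_space_distr) simp
  have "(\<integral>\<^sup>+\<omega>. h (X \<omega>, Z \<omega>) \<partial>M) = (\<integral>\<^sup>+p. h p \<partial>distr M borel (\<lambda>\<omega>. (X \<omega>, Z \<omega>)))"
    by (subst nn_integral_distr) (auto simp: borel_prod[symmetric])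
  also have "\<dots> = (\<integral>\<^sup>+x. \<integral>\<^sup>+z. h (x, z) \<partial>distr M borel Z \<partial>distr M borel X)"
    unfolding distr_indep_vectors[OF ind] by (rule Z.nn_integral_fst[symmetric]) simp
  also have "\<dots> = (\<integral>\<^sup>+\<omega>. \<integral>\<^sup>+z. h (X \<omega>, z) \<partial>distr M borel Z \<partial>M)"
    by (rule nn_integral_distr) (auto intro!: Z.borel_measurable_nn_integral_fst)
  also have "\<dots> = (\<integral>\<^sup>+\<omega>. \<integral>\<^sup>+\<omega>'. h (X \<omega>, Z \<omega>') \<partial>M \<partial>M)"
    by (intro nn_integral_cong nn_integral_distr) auto
  finally show ?thesis .
qed

text \<open>Integrating over \<open>Y\<close> first freezes the weights, so the equality of laws for constant \<open>w\<close> applies to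
  the inner integral.\<close>

lemma (in prob_space) nn_integral_weighted_mean_centered:
  fixes Y :: "'a \<Rightarrow> real ^ 'k ^ 'n" and W :: "'a \<Rightarrow> real ^ 'n"
  assumes iid: "iid_gaussian_sample M Y \<mu>" and ind: "indep_vectors M W Y"
    and f [measurable]: "f \<in> borel_measurable borel"
  shows "(\<integral>\<^sup>+\<omega>. f (weighted_mean (centered (W \<omega>)) (Y \<omega>)) \<partial>M)
    = (\<integral>\<^sup>+\<omega>. \<integral>\<^sup>+\<omega>'. f (empirical_sd (W \<omega>) *\<^sub>R (emp_mean (Y \<omega>') - \<mu>)) \<partial>M \<partial>M)"
proof -
  have [measurable]: "(\<lambda>p :: (real ^ 'n) \<times> (real ^ 'k ^ 'n).
      weighted_mean (centered (fst p)) (snd p)) \<in> borel_measurable borel"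
    unfolding weighted_mean_def centered_def emp_mean_def vec_lambda_beta
    by (intro borel_measurable_continuous_onI continuous_intros)
  have Ym [measurable]: "(\<lambda>\<omega>. Y \<omega> $ i) \<in> borel_measurable M" for i
    using iid by (auto simp: iid_gaussian_sample_def gaussian_vector_def)
  have [measurable]: "(\<lambda>\<omega>. weighted_mean (centered w) (Y \<omega>)) \<in> borel_measurable M" for w
    unfolding weighted_mean_def by measurable
  have [measurable]: "(\<lambda>\<omega>. emp_mean (Y \<omega>)) \<in> borel_measurable M"
    unfolding emp_mean_def by measurable
  have "(\<integral>\<^sup>+\<omega>. f (weighted_mean (centered (W \<omega>)) (Y \<omega>)) \<partial>M)
      = (\<integral>\<^sup>+\<omega>. \<integral>\<^sup>+\<omega>'. f (weighted_mean (centered (W \<omega>)) (Y \<omega>')) \<partial>M \<partial>M)"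
    using nn_integral_indep_vectors[OF ind, of "\<lambda>p. f (weighted_mean (centered (fst p)) (snd p))"]
    by simp
  also have "\<dots> = (\<integral>\<^sup>+\<omega>. \<integral>\<^sup>+\<omega>'. f (empirical_sd (W \<omega>) *\<^sub>R (emp_mean (Y \<omega>') - \<mu>)) \<partial>M \<partial>M)"
  proof (rule nn_integral_cong)
    fix \<omega>
    have "(\<integral>\<^sup>+\<omega>'. f (weighted_mean (centered (W \<omega>)) (Y \<omega>')) \<partial>M)
        = (\<integral>\<^sup>+x. f x \<partial>distr M borel (\<lambda>\<omega>'. weighted_mean (centered (W \<omega>)) (Y \<omega>')))"
      by (simp add: nn_integral_distr)
    also have "\<dots> = (\<integral>\<^sup>+\<omega>'. f (empirical_sd (W \<omega>) *\<^sub>R (emp_mean (Y \<omega>') - \<mu>)) \<partial>M)"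
      unfolding distr_weighted_mean_centered[OF iid] by (simp add: nn_integral_distr)
    finally show "(\<integral>\<^sup>+\<omega>'. f (weighted_mean (centered (W \<omega>)) (Y \<omega>')) \<partial>M)
      = (\<integral>\<^sup>+\<omega>'. f (empirical_sd (W \<omega>) *\<^sub>R (emp_mean (Y \<omega>') - \<mu>)) \<partial>M)" .
  qed
  finally show ?thesis .
qed

text \<open>Finiteness of \<open>resampling_B\<close>: the Euclidean norm is at most the sum of the absolute values of the
  coordinates, and these are integrable because the weights are square integrable.\<close>

lemma (in prob_space) integrable_empirical_sd:
  fixes W :: "'a \<Rightarrow> real ^ 'n"
  assumes [measurable]: "W \<in> borel_measurable M" and sq: "\<And>i. integrable M (\<lambda>\<omega>. (W \<omega> $ i)\<^sup>2)"
  shows "integrable M (\<lambda>\<omega>. empirical_sd (W \<omega>))"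
proof (rule Bochner_Integration.integrable_bound)
  have sdm: "(empirical_sd :: real ^ 'n \<Rightarrow> real) \<in> borel_measurable borel"
    unfolding empirical_sd_def emp_mean_def
    by (intro borel_measurable_continuous_onI continuous_intros)
  show "(\<lambda>\<omega>. empirical_sd (W \<omega>)) \<in> borel_measurable M"
    using measurable_compose[OF assms(1) sdm] .
  have nth: "(\<lambda>w :: real ^ 'n. w $ i) \<in> borel_measurable borel" for i
    by (intro borel_measurable_continuous_onI continuous_intros)
  have "integrable M (\<lambda>\<omega>. W \<omega> $ i)" for i
    by (rule square_integrable_imp_integrable[OF measurable_compose[OF assms(1) nth] sq])
  then show "integrable M (\<lambda>\<omega>. \<Sum>i\<in>UNIV. \<bar>W \<omega> $ i - emp_mean (W \<omega>)\<bar>)"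
    unfolding emp_mean_def by auto
  have "norm (empirical_sd w) \<le> norm (\<Sum>i\<in>UNIV. \<bar>w $ i - emp_mean w\<bar>)" for w :: "real ^ 'n"
  proof -
    have "(1 / real CARD('n)) * (\<Sum>i\<in>UNIV. (w $ i - emp_mean w)\<^sup>2) \<le> 1 * (\<Sum>i\<in>UNIV. (w $ i - emp_mean w)\<^sup>2)"
      by (rule mult_right_mono) (auto simp: sum_nonneg Suc_le_eq)
    then have "empirical_sd w \<le> L2_set (\<lambda>i. w $ i - emp_mean w) UNIV"
      unfolding empirical_sd_def L2_set_def by (intro real_sqrt_le_mono) simp
    also have "\<dots> \<le> (\<Sum>i\<in>UNIV. \<bar>w $ i - emp_mean w\<bar>)"
      by (rule L2_set_le_sum_abs)
    finally show ?thesis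
      by (simp add: empirical_sd_nonneg)
  qed
  then show "AE \<omega> in M. norm (empirical_sd (W \<omega>)) \<le> norm (\<Sum>i\<in>UNIV. \<bar>W \<omega> $ i - emp_mean (W \<omega>)\<bar>)"
    by simp
qed

text \<open>In \<open>ereal\<close> a finite factor \<open>B \<ge> 0\<close> distributes over any difference of nonnegative numbers: for
  \<open>B > 0\<close> both sides of \<open>B * (\<infinity> - \<infinity>)\<close> have the conventional value \<open>\<infinity>\<close>, and for \<open>B = 0\<close> all products
  vanish.\<close>

lemma ext_expectation_scaled:
  assumes "B \<ge> 0"
    and "(\<integral>\<^sup>+\<omega>. ennreal (Z \<omega>) \<partial>N) = ennreal B * (\<integral>\<^sup>+\<omega>. ennreal (X \<omega>) \<partial>M)"
    and "(\<integral>\<^sup>+\<omega>. ennreal (- Z \<omega>) \<partial>N) = ennreal B * (\<integral>\<^sup>+\<omega>. ennreal (- X \<omega>) \<partial>M)"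
  shows "ereal B * ext_expectation M X = ext_expectation N Z"
proof -
  have "ereal B * (p - q) = ereal B * p - ereal B * q" if "p \<ge> 0" "q \<ge> 0" for p q :: ereal
    using that \<open>B \<ge> 0\<close> by (cases p; cases q) (auto simp: algebra_simps)
  then show ?thesis
    using assms by (simp add: ext_expectation_def times_ennreal.rep_eq enn2ereal_ennreal enn2ereal_nonneg)
qed

section \<open>Expectations of functions of the resampled mean\<close>

theorem proposition2p3:
  fixes M :: "'a measure"
    and Y :: "'a \<Rightarrow> real ^ 'k ^ 'n"
    and W :: "'a \<Rightarrow> real ^ 'n"
    and \<mu> :: "real ^ 'k"
  assumes "prob_space M"
    and "CARD('n) \<ge> 2"
    and "iid_gaussian_sample M Y \<mu>"
    and "resampling_weight M Y W"
  shows
    "(\<forall>\<phi> :: real ^ 'k \<Rightarrow> real.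
        \<phi> \<in> borel_measurable borel \<longrightarrow> positive_homogeneous \<phi> \<longrightarrow>
        expectation_exists M (\<lambda>\<omega>. \<phi> (emp_mean (Y \<omega>) - \<mu>)) \<longrightarrow>
        expectation_exists M (\<lambda>\<omega>. \<phi> (weighted_mean (centered (W \<omega>)) (Y \<omega>))) \<longrightarrow>
        ereal (resampling_B M W) * ext_expectation M (\<lambda>\<omega>. \<phi> (emp_mean (Y \<omega>) - \<mu>))
          = ext_expectation M (\<lambda>\<omega>. \<phi> (weighted_mean (centered (W \<omega>)) (Y \<omega>)))) \<and>
     ((AE \<omega> in M. (\<Sum>i\<in>UNIV. (W \<omega> $ i - emp_mean (W \<omega>))\<^sup>2) = real CARD('n)) \<longrightarrow>
        (\<forall>\<phi> :: real ^ 'k \<Rightarrow> real.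
           \<phi> \<in> borel_measurable borel \<longrightarrow>
           expectation_exists M (\<lambda>\<omega>. \<phi> (emp_mean (Y \<omega>) - \<mu>)) \<longrightarrow>
           expectation_exists M (\<lambda>\<omega>. \<phi> (weighted_mean (centered (W \<omega>)) (Y \<omega>))) \<longrightarrow>
           ereal (resampling_B M W) * ext_expectation M (\<lambda>\<omega>. \<phi> (emp_mean (Y \<omega>) - \<mu>))
             = ext_expectation M (\<lambda>\<omega>. \<phi> (weighted_mean (centered (W \<omega>)) (Y \<omega>)))) \<and>
        resampling_B M W = 1)"
proof -
  interpret prob_space M by fact
  note iid = assms(3)
  have W: "W \<in> borel_measurable M" and ind: "indep_vectors M W Y"
    and sq: "\<And>i. integrable M (\<lambda>\<omega>. (W \<omega> $ i)\<^sup>2)"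
    using assms(4) by (auto simp: resampling_weight_def)
  have B: "resampling_B M W = (LINT \<omega>|M. empirical_sd (W \<omega>))"
    by (simp add: resampling_B_def empirical_sd_def)
  have int: "integrable M (\<lambda>\<omega>. empirical_sd (W \<omega>))"
    by (rule integrable_empirical_sd[OF W sq])
  have B_nonneg: "resampling_B M W \<ge> 0"
    unfolding B by (simp add: empirical_sd_nonneg)
  have B_nn: "(\<integral>\<^sup>+\<omega>. ennreal (empirical_sd (W \<omega>)) \<partial>M) = ennreal (resampling_B M W)"
    unfolding B using int by (intro nn_integral_eq_integral) (auto simp: empirical_sd_nonneg)
  have Ym [measurable]: "(\<lambda>\<omega>. Y \<omega> $ i) \<in> borel_measurable M" for i
    using iid by (auto simp: iid_gaussian_sample_def gaussian_vector_def)
  have [measurable]: "(\<lambda>\<omega>. emp_mean (Y \<omega>)) \<in> borel_measurable M"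
    unfolding emp_mean_def by measurable
  note [measurable] = borel_measurable_integrable[OF int]
  show ?thesis
  proof (intro conjI allI impI)
    fix \<phi> :: "real ^ 'k \<Rightarrow> real"
    assume \<phi> [measurable]: "\<phi> \<in> borel_measurable borel" and hom: "positive_homogeneous \<phi>"
    \<comment> \<open>Taking \<open>c = 1\<close> and \<open>c = -1\<close> gives the positive and the negative part.\<close>
    have part: "(\<integral>\<^sup>+\<omega>. ennreal (c * \<phi> (weighted_mean (centered (W \<omega>)) (Y \<omega>))) \<partial>M)
        = ennreal (resampling_B M W) * (\<integral>\<^sup>+\<omega>. ennreal (c * \<phi> (emp_mean (Y \<omega>) - \<mu>)) \<partial>M)" for c
    proof -
      have "(\<integral>\<^sup>+\<omega>. ennreal (c * \<phi> (weighted_mean (centered (W \<omega>)) (Y \<omega>))) \<partial>M)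
          = (\<integral>\<^sup>+\<omega>. \<integral>\<^sup>+\<omega>'. ennreal (c * \<phi> (empirical_sd (W \<omega>) *\<^sub>R (emp_mean (Y \<omega>') - \<mu>))) \<partial>M \<partial>M)"
        by (rule nn_integral_weighted_mean_centered[OF iid ind]) measurable
      also have "\<dots> = (\<integral>\<^sup>+\<omega>. \<integral>\<^sup>+\<omega>'. ennreal (empirical_sd (W \<omega>)) * ennreal (c * \<phi> (emp_mean (Y \<omega>') - \<mu>)) \<partial>M \<partial>M)"
        using hom by (simp add: positive_homogeneous_def empirical_sd_nonneg mult.left_commute
            flip: ennreal_mult')
      also have "\<dots> = (\<integral>\<^sup>+\<omega>. ennreal (empirical_sd (W \<omega>)) \<partial>M) * (\<integral>\<^sup>+\<omega>'. ennreal (c * \<phi> (emp_mean (Y \<omega>') - \<mu>)) \<partial>M)"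
        by (simp add: nn_integral_cmult nn_integral_multc)
      finally show ?thesis
        unfolding B_nn .
    qed
    show "ereal (resampling_B M W) * ext_expectation M (\<lambda>\<omega>. \<phi> (emp_mean (Y \<omega>) - \<mu>))
          = ext_expectation M (\<lambda>\<omega>. \<phi> (weighted_mean (centered (W \<omega>)) (Y \<omega>)))"
      using part[of 1] part[of "-1"] by (intro ext_expectation_scaled[OF B_nonneg]) simp_all
  next
    assume "AE \<omega> in M. (\<Sum>i\<in>UNIV. (W \<omega> $ i - emp_mean (W \<omega>))\<^sup>2) = real CARD('n)"
    then have sd1: "AE \<omega> in M. empirical_sd (W \<omega>) = 1"
      by eventually_elim (simp add: empirical_sd_def)
    have "(LINT \<omega>|M. empirical_sd (W \<omega>)) = (LINT \<omega>|M. 1)"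
      by (rule integral_cong_AE) (use sd1 in auto)
    then show B1: "resampling_B M W = 1"
      by (simp add: B prob_space)
    fix \<phi> :: "real ^ 'k \<Rightarrow> real"
    assume \<phi> [measurable]: "\<phi> \<in> borel_measurable borel"
    have part: "(\<integral>\<^sup>+\<omega>. ennreal (c * \<phi> (weighted_mean (centered (W \<omega>)) (Y \<omega>))) \<partial>M)
        = ennreal (resampling_B M W) * (\<integral>\<^sup>+\<omega>. ennreal (c * \<phi> (emp_mean (Y \<omega>) - \<mu>)) \<partial>M)" for c
    proof -
      have "(\<integral>\<^sup>+\<omega>. ennreal (c * \<phi> (weighted_mean (centered (W \<omega>)) (Y \<omega>))) \<partial>M)
          = (\<integral>\<^sup>+\<omega>. \<integral>\<^sup>+\<omega>'. ennreal (c * \<phi> (empirical_sd (W \<omega>) *\<^sub>R (emp_mean (Y \<omega>') - \<mu>))) \<partial>M \<partial>M)"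
        by (rule nn_integral_weighted_mean_centered[OF iid ind]) measurable
      also have "\<dots> = (\<integral>\<^sup>+\<omega>. \<integral>\<^sup>+\<omega>'. ennreal (c * \<phi> (emp_mean (Y \<omega>') - \<mu>)) \<partial>M \<partial>M)"
        by (rule nn_integral_cong_AE) (use sd1 in \<open>eventually_elim, simp\<close>)
      finally show ?thesis
        by (simp add: B1 emeasure_space_1)
    qed
    show "ereal (resampling_B M W) * ext_expectation M (\<lambda>\<omega>. \<phi> (emp_mean (Y \<omega>) - \<mu>))
          = ext_expectation M (\<lambda>\<omega>. \<phi> (weighted_mean (centered (W \<omega>)) (Y \<omega>)))"
      using part[of 1] part[of "-1"] by (intro ext_expectation_scaled[OF B_nonneg]) simp_all
  qed
qed

end
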